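(* For all co-prime positive integers $a$ and $b$ satisfying $1<a<b$, the map $\phi_{(a,b)}\colon(\mathbb{N},+,0)\to(\mathcal{F}_{(a,b)},\star,1)$ is a monoid isomorphism.
   Context: $\mathbb{N}=\{0,1,2,\dots\}$. For co-prime integers $1<a<b$ and $p\in\mathbb{N}$, let $q=\lceil p\log b/\log a\rceil$ be the smallest nonnegative integer with $1\le a^q/b^p$. Then $q\ge p$. Put $d_{(a,b)}(p)=q-p$, $\phi_{(a,b)}(p)=\frac{a^{p+d_{(a,b)}(p)}}{b^p}$ and $\mathcal{F}_{(a,b)}=\{\phi_{(a,b)}(p):p\in\mathbb{N}\}$. The binary operation $\star$ on $\mathcal{F}_{(a,b)}$ is defined by $\phi_{(a,b)}(p_1)\star\phi_{(a,b)}(p_2)=\phi_{(a,b)}(p_1+p_2)$ for $p_1,p_2\in\mathbb{N}$ (it is well defined because $\phi_{(a,b)}$ is injective). *)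

theory Defs
  imports Complex_Main "HOL-Algebra.Group"
begin

definition q_exp :: "nat \<Rightarrow> nat \<Rightarrow> nat \<Rightarrow> nat" where
  "q_exp a b p = (LEAST q. 1 \<le> real a ^ q / real b ^ p)"

(* Natural-number subtraction does not truncate when 1 < a < b: see q_exp_ge. *)
definition d_exp :: "nat \<Rightarrow> nat \<Rightarrow> nat \<Rightarrow> nat" where
  "d_exp a b p = q_exp a b p - p"

definition phi :: "nat \<Rightarrow> nat \<Rightarrow> nat \<Rightarrow> real" where
  "phi a b p = real a ^ (p + d_exp a b p) / real b ^ p"

definition F_set :: "nat \<Rightarrow> nat \<Rightarrow> real set" where
  "F_set a b = {phi a b p | p. p \<in> (UNIV :: nat set)}"

(* The value on F_set is determined by star (phi p1) (phi p2) = phi (p1 + p2); uniqueness of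
   the described element is exactly well-definedness, which rests on injectivity of phi
   and is not presupposed.  Outside F_set the value is irrelevant. *)
definition star :: "nat \<Rightarrow> nat \<Rightarrow> real \<Rightarrow> real \<Rightarrow> real" where
  "star a b x y =
     (THE z. \<exists>p1 p2. x = phi a b p1 \<and> y = phi a b p2 \<and> z = phi a b (p1 + p2))"

definition nat_add_monoid :: "nat monoid" where
  "nat_add_monoid = \<lparr>carrier = UNIV, mult = (+), one = 0\<rparr>"

definition F_monoid :: "nat \<Rightarrow> nat \<Rightarrow> real monoid" where
  "F_monoid a b = \<lparr>carrier = F_set a b, mult = star a b, one = 1\<rparr>"

lemma q_exp_eq_ceiling:
  assumes "1 < a" "a < b"
  shows "int (q_exp a b p) = \<lceil>real p * ln (real b) / ln (real a)\<rceil>"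
proof -
  have lna: "ln (real a) > 0" and lnb: "ln (real b) > 0"
    using assms by simp_all
  have iff: "1 \<le> real a ^ q / real b ^ p \<longleftrightarrow> real p * ln (real b) / ln (real a) \<le> real q" for q
  proof -
    have "1 \<le> real a ^ q / real b ^ p \<longleftrightarrow> real b ^ p \<le> real a ^ q"
      using assms by (simp add: field_simps)
    also have "\<dots> \<longleftrightarrow> ln (real b ^ p) \<le> ln (real a ^ q)"
      using assms by (subst ln_le_cancel_iff) simp_all
    also have "\<dots> \<longleftrightarrow> real p * ln (real b) \<le> real q * ln (real a)"
      using assms by (simp add: ln_realpow)
    also have "\<dots> \<longleftrightarrow> real p * ln (real b) / ln (real a) \<le> real q"
      using lna by (simp add: pos_divide_le_eq)
    finally show ?thesis .
  qed
  define c where "c = real p * ln (real b) / ln (real a)"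
  have c0: "c \<ge> 0"
    using lna lnb by (simp add: c_def)
  have "q_exp a b p = nat \<lceil>c\<rceil>"
    unfolding q_exp_def iff c_def[symmetric]
    by (rule Least_equality) (use c0 in linarith)+
  then show ?thesis
    using c0 by (simp add: c_def)
qed

lemma q_exp_ge:
  assumes "1 < a" "a < b"
  shows "p \<le> q_exp a b p"
proof -
  have "ln (real a) > 0" "ln (real a) \<le> ln (real b)"
    using assms by simp_all
  then have "real p \<le> real p * ln (real b) / ln (real a)"
    by (simp add: pos_le_divide_eq mult_left_mono)
  then have "int p \<le> \<lceil>real p * ln (real b) / ln (real a)\<rceil>"
    by linarith
  then show ?thesis
    using q_exp_eq_ceiling[OF assms, of p] by linarith
qed

end

theory Submission
  imports Defs
begin

text \<open>The operation \<open>star\<close> is addition carried over along \<open>phi\<close>, so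
  the claim reduces to injectivity of \<open>phi\<close> (\<open>inj_phi\<close>): injectivity makes
  \<open>star\<close> well defined (\<open>star_phi\<close>), and the monoid laws and the
  homomorphism property are then inherited from the natural numbers. Injectivity is a divisibility
  fact: since a and b are coprime, the power of b in the denominator of a^q / b^p cannot cancel, so
  the value determines p.\<close>

lemma phi_eq_q_exp:
  assumes "1 < a" "a < b"
  shows "phi a b p = real a ^ q_exp a b p / real b ^ p"
  using q_exp_ge[OF assms] by (simp add: phi_def d_exp_def)

lemma phi_0: "phi a b 0 = 1"
  by (simp add: phi_def d_exp_def q_exp_def)

text \<open>Cross-multiplying gives a^m b^r = a^n b^p over the naturals, so b^p divides a^m b^r and,
  by coprimality, b^r. This is one half of injectivity; exchanging the two fractions gives the
  other.\<close>

lemma exponent_le_if_fraction_eq: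
  fixes a b :: nat
  assumes "coprime a b" "1 < b"
    and eq: "real a ^ m / real b ^ p = real a ^ n / real b ^ r"
  shows "p \<le> r"
proof -
  have "real (a ^ m * b ^ r) = real (a ^ n * b ^ p)"
    using eq assms(2) by (simp add: field_simps)
  then have "a ^ m * b ^ r = a ^ n * b ^ p"
    by (simp only: of_nat_eq_iff)
  then have "b ^ p dvd a ^ m * b ^ r"
    by simp
  moreover have "coprime (b ^ p) (a ^ m)"
    using assms(1) by (simp add: coprime_commute)
  ultimately have "b ^ p dvd b ^ r"
    using coprime_dvd_mult_right_iff by blast
  then show ?thesis
    using assms(2) by (simp add: power_dvd_imp_le)
qed

lemma inj_phi:
  assumes "coprime a b" "1 < a" "a < b"
  shows "inj (phi a b)"
proof (rule injI)
  fix p r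
  assume "phi a b p = phi a b r"
  then have "real a ^ q_exp a b p / real b ^ p = real a ^ q_exp a b r / real b ^ r"
    using assms by (simp add: phi_eq_q_exp)
  moreover have "1 < b"
    using assms by simp
  ultimately show "p = r"
    using exponent_le_if_fraction_eq[OF assms(1)] by (metis antisym)
qed

text \<open>Injectivity recovers p and r from their images, so the description in
  \<open>star\<close> has exactly one solution.\<close>

lemma star_phi:
  assumes "inj (phi a b)"
  shows "star a b (phi a b p) (phi a b r) = phi a b (p + r)"
  unfolding star_def using assms by (intro the_equality) (auto dest: injD)

theorem theorem4p3:
  fixes a b :: nat
  assumes "coprime a b" and "1 < a" and "a < b"
  shows "monoid nat_add_monoid \<and> monoid (F_monoid a b) \<and>
         phi a b \<in> iso nat_add_monoid (F_monoid a b) \<and>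
         phi a b \<one>\<^bsub>nat_add_monoid\<^esub> = \<one>\<^bsub>F_monoid a b\<^esub>"
proof -
  note inj = inj_phi[OF assms]
  note star = star_phi[OF inj]
  have F: "F_set a b = range (phi a b)"
    by (auto simp: F_set_def)
  \<comment> \<open>The unit 1 is \<open>phi a b 0\<close>, so the unit laws are the cases 0 + p and
    p + 0 of \<open>star\<close>.\<close>
  have star_1: "star a b 1 (phi a b p) = phi a b p" "star a b (phi a b p) 1 = phi a b p" for p
    using star[of 0 p] star[of p 0] by (simp_all add: phi_0)
  have "monoid nat_add_monoid"
    by unfold_locales (auto simp: nat_add_monoid_def)
  moreover have "monoid (F_monoid a b)"
  proof (rule monoidI)
    show "\<one>\<^bsub>F_monoid a b\<^esub> \<in> carrier (F_monoid a b)"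
      unfolding F_monoid_def F by (simp flip: phi_0[of a b])
  qed (auto simp: F_monoid_def F star star_1 add.assoc)
  moreover have "phi a b \<in> iso nat_add_monoid (F_monoid a b)"
    using inj by (auto simp: iso_def hom_def bij_betw_def nat_add_monoid_def F_monoid_def F star)
  moreover have "phi a b \<one>\<^bsub>nat_add_monoid\<^esub> = \<one>\<^bsub>F_monoid a b\<^esub>"
    by (simp add: nat_add_monoid_def F_monoid_def phi_0)
  ultimately show ?thesis
    by blast
qed

end
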